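(* Let $0<l_z<1$ and let $\mathcal F'=\{(x,y,z)\in\mathbb R^3 : z=xy,\ 0\le x\le 1,\ 0\le y\le 1,\ l_z\le z\le 1\}$. Then the volume (three-dimensional Lebesgue measure) of $\operatorname{conv}(\mathcal F')$ is $$\frac{1-l_z}{6}\left(1+2l_z\ln(l_z)-l_z^2\right).$$
   Context: $\operatorname{conv}$ denotes the convex hull in $\mathbb R^3$. *)

theory Defs
  imports "HOL-Analysis.Analysis"
begin

definition bounded_product_graph :: "real \<Rightarrow> (real ^ 3) set" where
  "bounded_product_graph l =
     {v. v $ 3 = v $ 1 * v $ 2 \<and> 0 \<le> v $ 1 \<and> v $ 1 \<le> 1 \<and> 0 \<le> v $ 2 \<and> v $ 2 \<le> 1 \<and>
         l \<le> v $ 3 \<and> v $ 3 \<le> 1}"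

end

(* Put the height z first and write l for l_z. The convex hull is the cone with apex (1, 1, 1) over the
   planar region B given by l <= xy, x + y <= 1 + l, placed at height l, so its volume is a third of
   height times base area. B lies in the hull: a line x + y = s that meets B meets the curve xy = l
   in two points (r, s - r) and (s - r, r), and the part of the line in B lies between them.
   Conversely, let (u, v) = (1 - x, 1 - y) and t = (1 - xy) / (1 - l) for a point of the graph.
   Projecting it from the apex to height l gives (1 - u/t, 1 - v/t); the linear inequality of B
   for this point reduces to u v >= 0 and the quadratic one to (1 - t) u v >= 0. *)
theory Submission
  imports Defs
begin

section \<open>Volumes of cones\<close>

lemma emeasure_lborel_slices:
  fixes A :: "('a::euclidean_space \<times> 'b::euclidean_space) set"
  assumes "A \<in> sets borel"
  shows "emeasure lborel A = (\<integral>\<^sup>+x. emeasure lborel (Pair x -` A) \<partial>lborel)"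
proof -
  have "A \<in> sets (lborel \<Otimes>\<^sub>M lborel)"
    using assms by (simp only: lborel_prod sets_lborel)
  then have "emeasure (lborel \<Otimes>\<^sub>M lborel) A = (\<integral>\<^sup>+x. emeasure lborel (Pair x -` A) \<partial>lborel)"
    by (rule lborel.emeasure_pair_measure_alt)
  then show ?thesis by (simp only: lborel_prod)
qed

text \<open>The apex is \<open>(b, p)\<close>, and \<open>t\<close> runs from 0 at the apex to 1 at
  the base, which sits at height \<open>b - h\<close>. Height is the first coordinate, so preimages
  under \<open>Pair z\<close> are the horizontal cross sections.\<close>

definition cone_over :: "real \<Rightarrow> real \<Rightarrow> 'a::euclidean_space \<Rightarrow> 'a set \<Rightarrow> (real \<times> 'a) set" where
  "cone_over b h p S = (\<lambda>(t, x). (b - t * h, (1 - t) *\<^sub>R p + t *\<^sub>R x)) ` ({0..1} \<times> S)"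

lemma compact_cone_over:
  assumes "compact S"
  shows "compact (cone_over b h p S)"
  unfolding cone_over_def case_prod_beta
  by (intro compact_continuous_image compact_Times assms compact_Icc continuous_intros)

text \<open>The height \<open>z\<close> fixes \<open>t = (b - z) / h\<close>, so a slice is a scaled
  and translated base. The translation is written last to match
  \<open>emeasure_lebesgue_affine\<close>.\<close>

lemma slice_cone_over:
  assumes "h > 0"
  shows "Pair z -` cone_over b h p S =
    (if z \<in> {b - h..b}
     then (\<lambda>x. ((b - z) / h) *\<^sub>R x + (1 - (b - z) / h) *\<^sub>R p) ` S else {})"
proof (cases "z \<in> {b - h..b}")
  case True
  have eq: "z = b - t * h \<longleftrightarrow> t = (b - z) / h" for t
    using assms by (auto simp: field_simps)
  have "(b - z) / h \<in> {0..1}"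
    using True assms by (auto simp: field_simps)
  then show ?thesis
    using True by (auto simp: cone_over_def image_iff eq add.commute)
next
  case False
  have "z \<in> {b - h..b}" if "(z, x) \<in> cone_over b h p S" for x
  proof -
    obtain t where "t \<in> {0..1}" "z = b - t * h"
      using \<open>(z, x) \<in> cone_over b h p S\<close> by (auto simp: cone_over_def)
    then show ?thesis
      using assms by (auto intro: mult_left_le_one_le)
  qed
  then show ?thesis using False by auto
qed

text \<open>Cavalieri: the slice at ratio \<open>t\<close> has measure \<open>t ^ DIM('a)\<close>
  times that of the base, and integrating over the height gives the factor
  \<open>h / (DIM('a) + 1)\<close>.\<close>

lemma emeasure_cone_over:
  fixes S :: "'a::euclidean_space set"
  assumes S: "compact S" and h: "h > 0"
  shows "emeasure lborel (cone_over b h p S) = ennreal (h * measure lborel S / (DIM('a) + 1))"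
proof -
  define m where "m = measure lborel S"
  have mS: "emeasure lebesgue S = ennreal m"
    using emeasure_compact_finite[OF S] emeasure_eq_ennreal_measure[of lborel S]
    by (simp add: m_def borel_compact S less_top)
  have m0: "m \<ge> 0" by (simp add: m_def)
  have [measurable]: "cone_over b h p S \<in> sets borel"
    using compact_cone_over[OF S] by (rule borel_compact)
  have slice: "emeasure lborel (Pair z -` cone_over b h p S) =
      ennreal (m * ((b - z) / h) ^ DIM('a)) * indicator {b - h..b} z" for z
  proof (cases "z \<in> {b - h..b}")
    case True
    let ?I = "(\<lambda>x. ((b - z) / h) *\<^sub>R x + (1 - (b - z) / h) *\<^sub>R p) ` S"
    have t0: "(b - z) / h \<ge> 0" using True h by auto
    have "compact ?I"
      by (intro compact_continuous_image S continuous_intros)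
    then have "emeasure lborel ?I = emeasure lebesgue ?I"
      by (simp add: borel_compact)
    also have "\<dots> = ennreal (m * ((b - z) / h) ^ DIM('a))"
      using t0 m0 by (simp only: emeasure_lebesgue_affine mS abs_of_nonneg)
        (simp add: ennreal_mult ennreal_power mult.commute)
    finally show ?thesis using True h by (simp add: slice_cone_over)
  next
    case False
    then show ?thesis by (simp only: slice_cone_over[OF h] if_False) simp
  qed
  \<comment> \<open>This antiderivative vanishes at the apex height \<open>z = b\<close>. At
    \<open>z = b - h\<close> the ratio is 1, so only the constant in front survives.\<close>
  let ?F = "\<lambda>z. - (h * m / (DIM('a) + 1)) * ((b - z) / h) ^ (DIM('a) + 1)"
  have deriv: "(?F has_real_derivative m * ((b - z) / h) ^ DIM('a)) (at z)" for z
  proof -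
    have "((\<lambda>z. (b - z) / h) has_real_derivative - 1 / h) (at z)"
      using h by (auto intro!: derivative_eq_intros)
    from DERIV_cmult[OF DERIV_power[OF this, of "DIM('a) + 1"], of "- (h * m / (DIM('a) + 1))"]
    have "(?F has_real_derivative - (h * m / real (DIM('a) + 1)) *
        (real (DIM('a) + 1) * (- 1 / h * ((b - z) / h) ^ DIM('a)))) (at z)"
      by simp
    moreover have "- (h * m / n) * (n * (- 1 / h * w)) = m * w" if "n > 0" for n w :: real
      using h that by simp
    ultimately show ?thesis by (metis of_nat_0_less_iff add_gr_0 zero_less_one)
  qed
  have "emeasure lborel (cone_over b h p S) =
      (\<integral>\<^sup>+z. emeasure lborel (Pair z -` cone_over b h p S) \<partial>lborel)"
    by (rule emeasure_lborel_slices) measurable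
  also have "\<dots> = (\<integral>\<^sup>+z. ennreal (m * ((b - z) / h) ^ DIM('a)) * indicator {b - h..b} z \<partial>lborel)"
    by (simp only: slice)
  also have "\<dots> = ennreal (?F b - ?F (b - h))"
    using h m0 deriv by (intro nn_integral_FTC_Icc) auto
  also have "?F b - ?F (b - h) = h * m / (DIM('a) + 1)"
    using h by simp
  finally show ?thesis by (simp add: m_def)
qed

section \<open>The base of the cone\<close>

text \<open>For 0 < l < 1 this is the planar region between the hyperbola xy = l and its chord from
  (l, 1) to (1, l); \<open>0 \<le> x\<close> selects the positive branch.\<close>

definition base_region :: "real \<Rightarrow> (real \<times> real) set" where
  "base_region l = {(x, y). 0 \<le> x \<and> l \<le> x * y \<and> x + y \<le> 1 + l}"

lemma base_region_pos:
  assumes "0 < l" "(x, y) \<in> base_region l"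
  shows "0 < x" "0 < y"
proof -
  have "0 < x * y" "0 \<le> x" using assms by (auto simp: base_region_def)
  then show "0 < x" "0 < y" by (auto simp: zero_less_mult_iff)
qed

lemma compact_base_region:
  assumes "0 < l"
  shows "compact (base_region l)"
proof -
  have "closed (base_region l)"
    unfolding base_region_def case_prod_beta
    by (intro closed_Collect_conj closed_Collect_le continuous_intros)
  moreover have "base_region l \<subseteq> cbox (0, 0) (1 + l, 1 + l)"
    using base_region_pos[OF assms] by (force simp: cbox_Pair_eq base_region_def)
  ultimately show ?thesis
    using bounded_subset[OF bounded_cbox] compact_eq_bounded_closed by blast
qed

text \<open>Expanding the product of the coordinates of \<open>u *\<^sub>R p + v *\<^sub>R q\<close>
  produces the cross term \<open>x * y' + x' * y\<close>. Its two summands have product at least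
  l^2, so by AM-GM it is at least 2l.\<close>

lemma convex_base_region:
  assumes l: "0 < l"
  shows "convex (base_region l)"
proof (rule convexI)
  fix p q :: "real \<times> real" and u v :: real
  assume p: "p \<in> base_region l" and q: "q \<in> base_region l"
    and u: "0 \<le> u" and v: "0 \<le> v" and uv: "u + v = 1"
  obtain x y where xy: "p = (x, y)" by (cases p)
  obtain x' y' where xy': "q = (x', y')" by (cases q)
  note pos = base_region_pos[OF l p[unfolded xy]] base_region_pos[OF l q[unfolded xy']]
  have a: "l \<le> x * y" "l \<le> x' * y'" "x + y \<le> 1 + l" "x' + y' \<le> 1 + l"
    using p q by (auto simp: xy xy' base_region_def)
  have "(2 * l)\<^sup>2 \<le> 4 * ((x * y) * (x' * y'))"
    using mult_mono[OF a(1,2)] l pos by (simp add: power2_eq_square)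
  also have "\<dots> \<le> (x * y' + x' * y)\<^sup>2"
    using zero_le_power2[of "x * y' - x' * y"] by (simp add: power2_eq_square algebra_simps)
  finally have cross: "2 * l \<le> x * y' + x' * y"
    by (rule power2_le_imp_le) (use pos in simp)
  \<comment> \<open>The weights u^2, v^2 and 2uv sum to 1, so \<open>l\<close> can be split to match
    the expanded product term by term.\<close>
  have "l = l * (u + v)\<^sup>2" by (simp add: uv)
  also have "\<dots> = u\<^sup>2 * l + v\<^sup>2 * l + (u * v) * (2 * l)"
    by (simp add: power2_eq_square algebra_simps)
  also have "\<dots> \<le> u\<^sup>2 * (x * y) + v\<^sup>2 * (x' * y') + (u * v) * (x * y' + x' * y)"
    using a cross u v by (intro add_mono mult_left_mono) auto
  also have "\<dots> = (u * x + v * x') * (u * y + v * y')"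
    by (simp add: power2_eq_square algebra_simps)
  finally have prod: "l \<le> (u * x + v * x') * (u * y + v * y')" .
  have "(u * x + v * x') + (u * y + v * y') = u * (x + y) + v * (x' + y')"
    by (simp add: algebra_simps)
  also have "\<dots> \<le> u * (1 + l) + v * (1 + l)"
    by (rule add_mono[OF mult_left_mono mult_left_mono]) (use a u v in auto)
  also have "\<dots> = 1 + l" using uv by (metis distrib_right mult_1)
  finally show "u *\<^sub>R p + v *\<^sub>R q \<in> base_region l"
    using prod pos u v by (simp add: xy xy' base_region_def)
qed

lemma slice_base_region:
  assumes l: "0 < l" "l < 1"
  shows "Pair x -` base_region l = (if x \<in> {l..1} then {l / x..1 + l - x} else {})"
proof -
  have "x \<in> {l..1}" if "(x, y) \<in> base_region l" for y
  proof -
    note pos = base_region_pos[OF l(1) that]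
    have "l \<le> x * y" "y \<le> 1 + l - x" using that by (auto simp: base_region_def)
    \<comment> \<open>Eliminating \<open>y\<close> leaves a quadratic inequality in \<open>x\<close>
      whose roots \<open>l\<close> and 1 are the abscissae of the chord's ends.\<close>
    then have "l \<le> x * (1 + l - x)"
      using pos by (meson mult_left_mono less_imp_le order_trans)
    then have "(x - l) * (1 - x) \<ge> 0" by (simp add: algebra_simps)
    then show ?thesis using l by (auto simp: zero_le_mult_iff)
  qed
  then have out: "Pair x -` base_region l = {}" if "x \<notin> {l..1}"
    using that by blast
  have "(x, y) \<in> base_region l \<longleftrightarrow> y \<in> {l / x..1 + l - x}" if "x \<in> {l..1}" for y
    using that l by (auto simp: base_region_def field_simps)
  then have "Pair x -` base_region l = {l / x..1 + l - x}" if "x \<in> {l..1}"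
    using that by blast
  with out show ?thesis by presburger
qed

text \<open>The area is the integral over \<open>{l..1}\<close> of the slice length
  \<open>1 + l - x - l / x\<close>, which is nonnegative by the same factorization that bounds
  \<open>x\<close>.\<close>

lemma measure_base_region:
  assumes l: "0 < l" "l < 1"
  shows "measure lborel (base_region l) = (1 - l\<^sup>2) / 2 + l * ln l"
proof -
  have [measurable]: "base_region l \<in> sets borel"
    using compact_base_region[OF l(1)] by (rule borel_compact)
  have nonneg: "0 \<le> 1 + l - x - l / x" if "x \<in> {l..1}" for x
  proof -
    have "1 + l - x - l / x = (x - l) * (1 - x) / x"
      using that l by (simp add: field_simps)
    then show ?thesis using that l by simp
  qed
  let ?F = "\<lambda>x. (1 + l) * x - x\<^sup>2 / 2 - l * ln x"
  have deriv: "(?F has_real_derivative (1 + l - x - l / x)) (at x)" if "x \<in> {l..1}" for x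
    using that l by (auto intro!: derivative_eq_intros)
  have slice: "emeasure lborel (Pair x -` base_region l) =
      ennreal (1 + l - x - l / x) * indicator {l..1} x" for x
    using nonneg[of x] by (auto simp: slice_base_region[OF l])
  have "emeasure lborel (base_region l) =
      (\<integral>\<^sup>+x. emeasure lborel (Pair x -` base_region l) \<partial>lborel)"
    by (rule emeasure_lborel_slices) measurable
  also have "\<dots> = (\<integral>\<^sup>+x. ennreal (1 + l - x - l / x) * indicator {l..1} x \<partial>lborel)"
    by (simp only: slice)
  also have "\<dots> = ennreal (?F 1 - ?F l)"
    using l nonneg deriv by (intro nn_integral_FTC_Icc) auto
  also have "?F 1 - ?F l = (1 - l\<^sup>2) / 2 + l * ln l"
    by (simp add: power2_eq_square field_simps)
  finally have *: "emeasure lborel (base_region l) = ennreal ((1 - l\<^sup>2) / 2 + l * ln l)" .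
  \<comment> \<open>\<open>ennreal\<close> sends negative reals to 0, so the value must be shown
    nonnegative before it can be read off as a real; monotonicity of the antiderivative gives
    this.\<close>
  have "?F l \<le> ?F 1"
    using l deriv nonneg
    by (intro DERIV_nonneg_imp_nondecreasing[of l 1 ?F]) (auto intro!: exI)
  then have "0 \<le> (1 - l\<^sup>2) / 2 + l * ln l"
    by (simp add: power2_eq_square field_simps)
  then show ?thesis using * by (simp add: measure_def)
qed

section \<open>The convex hull as a cone\<close>

text \<open>The set of the theorem as nested pairs, with the height moved to the front to fit
  \<open>cone_over\<close>.\<close>

definition bilinear_graph :: "real \<Rightarrow> (real \<times> real \<times> real) set" where
  "bilinear_graph l =
     {(z, x, y). z = x * y \<and> 0 \<le> x \<and> x \<le> 1 \<and> 0 \<le> y \<and> y \<le> 1 \<and> l \<le> z \<and> z \<le> 1}"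

text \<open>The hull of a point and a nonempty convex set is the union of the segments joining them.
  For empty \<open>S\<close> the cone is empty, while the hull still contains the apex.\<close>

lemma cone_over_eq_hull:
  assumes "convex S" "S \<noteq> {}"
  shows "cone_over b h p S = convex hull (insert (b, p) ({b - h} \<times> S))"
proof -
  have eq: "convex hull ({b - h} \<times> S) = {b - h} \<times> S"
    using assms by (simp add: hull_same convex_Times)
  have "cone_over b h p S =
      {(1 - u) *\<^sub>R (b, p) + u *\<^sub>R q |q u. 0 \<le> u \<and> u \<le> 1 \<and> q \<in> {b - h} \<times> S}"
  proof (intro antisym subsetI)
    fix q assume "q \<in> cone_over b h p S"
    then obtain t x where "0 \<le> t" "t \<le> 1" "x \<in> S"
        "q = (b - t * h, (1 - t) *\<^sub>R p + t *\<^sub>R x)"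
      by (auto simp: cone_over_def)
    then show "q \<in> {(1 - u) *\<^sub>R (b, p) + u *\<^sub>R q |q u. 0 \<le> u \<and> u \<le> 1 \<and> q \<in> {b - h} \<times> S}"
      by (intro CollectI exI[of _ "(b - h, x)"] exI[of _ t]) (auto simp: algebra_simps)
  next
    fix q assume "q \<in> {(1 - u) *\<^sub>R (b, p) + u *\<^sub>R q |q u. 0 \<le> u \<and> u \<le> 1 \<and> q \<in> {b - h} \<times> S}"
    then obtain t x where "0 \<le> t" "t \<le> 1" "x \<in> S"
        "q = (1 - t) *\<^sub>R (b, p) + t *\<^sub>R (b - h, x)"
      by auto
    then show "q \<in> cone_over b h p S"
      unfolding cone_over_def by (intro image_eqI[of _ _ "(t, x)"]) (auto simp: algebra_simps)
  qed
  then show ?thesis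
    using assms by (simp add: convex_hull_insert_alt eq)
qed

lemma bilinear_graph_subset_cone:
  assumes l: "0 < l" "l < 1"
  shows "bilinear_graph l \<subseteq> cone_over 1 (1 - l) (1, 1) (base_region l)"
proof
  fix q assume "q \<in> bilinear_graph l"
  then obtain x y where q: "q = (x * y, x, y)"
    and x: "0 \<le> x" "x \<le> 1" and y: "0 \<le> y" "y \<le> 1" and z: "l \<le> x * y"
    by (auto simp: bilinear_graph_def)
  \<comment> \<open>Chosen so that \<open>1 - t * (1 - l)\<close> is the height
    \<open>x * y\<close>.\<close>
  define t where "t = (1 - x * y) / (1 - l)"
  define u where "u = 1 - x"
  define v where "v = 1 - y"
  have uv: "0 \<le> u" "u \<le> 1" "0 \<le> v" "v \<le> 1" using x y by (auto simp: u_def v_def)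
  have tl: "t * (1 - l) = u + v - u * v"
    using l by (simp add: t_def u_def v_def field_simps)
  have t: "0 \<le> t" "t \<le> 1"
    using l z mult_le_one[OF x(2) y] by (auto simp: t_def)
  show "q \<in> cone_over 1 (1 - l) (1, 1) (base_region l)"
  \<comment> \<open>Projection from the apex divides by \<open>t\<close>. If \<open>t = 0\<close>,
    the point is the apex itself, and any base point, here (1, l), serves as witness.\<close>
  proof (cases "t = 0")
    case True
    then have "u * (1 - v) + v = 0" using tl by (simp add: algebra_simps)
    moreover have "0 \<le> u * (1 - v)" using uv by simp
    ultimately have "v = 0" using uv by linarith
    with tl True have "u = 0" by simp
    with \<open>v = 0\<close> have "q = (1, 1, 1)" by (simp add: q u_def v_def)
    moreover have "(1, l) \<in> base_region l" using l by (simp add: base_region_def)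
    ultimately show ?thesis
      unfolding cone_over_def by (intro image_eqI[of _ _ "(0, 1, l)"]) auto
  next
    case False
    then have t0: "0 < t" using t by simp
    \<comment> \<open>The difference of the two sides is v(1 - u) + ul; the bound
      \<open>u \<le> t\<close> makes the projected abscissa nonnegative.\<close>
    have "u * (1 - l) \<le> t * (1 - l)"
    proof -
      have "0 \<le> v * (1 - u) + u * l" using uv l by simp
      then show ?thesis unfolding tl by (simp add: algebra_simps)
    qed
    then have "u \<le> t" using l by simp
    then have 1: "0 \<le> 1 - u / t" using t0 by simp
    have "t * (1 - l) \<le> u + v" using tl uv by simp
    then have 2: "(1 - u / t) + (1 - v / t) \<le> 1 + l"
    proof -
      have "1 - l \<le> (u + v) / t"
        using t0 \<open>t * (1 - l) \<le> u + v\<close> by (simp add: pos_le_divide_eq mult.commute)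
      then show ?thesis by (simp add: add_divide_distrib)
    qed
    \<comment> \<open>The quadratic condition multiplied by t^2, with \<open>t * l\<close> replaced
      by means of \<open>tl\<close>.\<close>
    have "t * (t * l) = t * (t - (u + v - u * v))"
      using tl by (simp add: algebra_simps)
    also have "\<dots> = (t - u) * (t - v) - (1 - t) * (u * v)"
      by (simp add: algebra_simps)
    also have "\<dots> \<le> (t - u) * (t - v)"
      using t uv by simp
    finally have "l \<le> (t - u) * (t - v) / (t * t)"
      using t0 by (simp add: field_simps)
    also have "\<dots> = (1 - u / t) * (1 - v / t)"
      using t0 by (simp add: field_simps)
    finally have "(1 - u / t, 1 - v / t) \<in> base_region l"
      using 1 2 by (simp add: base_region_def)
    moreover have "q = (1 - t * (1 - l), (1 - t) *\<^sub>R (1, 1) + t *\<^sub>R (1 - u / t, 1 - v / t))"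
    proof -
      have "t * (1 - u / t) = t - u" "t * (1 - v / t) = t - v"
        using t0 by (simp_all add: right_diff_distrib)
      moreover have "x * y = 1 - t * (1 - l)"
        unfolding tl by (simp add: u_def v_def algebra_simps)
      ultimately show ?thesis by (simp add: q u_def v_def)
    qed
    ultimately show ?thesis
      unfolding cone_over_def using t
      by (intro image_eqI[of _ _ "(t, 1 - u / t, 1 - v / t)"]) auto
  qed
qed

lemma base_region_subset_hull:
  assumes l: "0 < l" "l < 1"
  shows "{l} \<times> base_region l \<subseteq> convex hull (bilinear_graph l)"
proof clarify
  fix x y assume xy: "(x, y) \<in> base_region l"
  note pos = base_region_pos[OF l(1) xy]
  define s where "s = x + y"
  \<comment> \<open>\<open>d\<close> is the difference of the roots of X^2 - sX + l, which are the
    coordinates of the points where x + y = s meets xy = l; \<open>r\<close> below is the larger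
    root.\<close>
  define d where "d = sqrt (s\<^sup>2 - 4 * l)"
  have "4 * l \<le> s\<^sup>2 - (x - y)\<^sup>2"
    using xy by (simp add: base_region_def s_def power2_eq_square algebra_simps)
  then have sl: "(x - y)\<^sup>2 \<le> s\<^sup>2 - 4 * l" by simp
  then have d2: "d\<^sup>2 = s\<^sup>2 - 4 * l" "0 \<le> d"
    using order_trans[OF zero_le_power2 sl] by (auto simp: d_def)
  have "\<bar>x - y\<bar> \<le> d" using sl d_def real_le_rsqrt by auto
  have ds: "d \<le> s"
    by (rule power2_le_imp_le) (use d2 l pos in \<open>auto simp: s_def\<close>)
  have s1: "s \<le> 1 + l" using xy by (simp add: base_region_def s_def)
  define r where "r = (s + d) / 2"
  have prod: "r * (s - r) = l"
    using d2(1) by (simp add: r_def power2_eq_square field_simps)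
  have r: "s - r \<le> r" "0 \<le> s - r" using d2 ds by (auto simp: r_def field_simps)
  \<comment> \<open>If r > 1 > l, then (r - 1)(r - l) > 0 says r(1 + l - r) < l, which contradicts
    r(s - r) = l and s <= 1 + l.\<close>
  have "r \<le> 1"
  proof (rule ccontr)
    assume "\<not> r \<le> 1"
    have "0 < (r - 1) * (r - l)" using \<open>\<not> r \<le> 1\<close> l by simp
    then have "r * (1 + l - r) < l" by (simp add: algebra_simps)
    moreover have "r * (s - r) \<le> r * (1 + l - r)"
      using s1 r by (intro mult_left_mono) auto
    ultimately show False using prod by simp
  qed
  then have mem: "(l, r, s - r) \<in> bilinear_graph l" "(l, s - r, r) \<in> bilinear_graph l"
    using r prod l by (auto simp: bilinear_graph_def mult.commute)
  have bnd: "s - r \<le> x" "x \<le> r"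
    using \<open>\<bar>x - y\<bar> \<le> d\<close> by (auto simp: r_def s_def abs_le_iff field_simps)
  have "(x, y) \<in> closed_segment (s - r, r) (r, s - r)"
  \<comment> \<open>In the case of equality the line is tangent to the hyperbola and the segment is
    one point; otherwise the weight \<open>w\<close> is solved from \<open>x\<close>, and
    \<open>y\<close> follows since the sum is constant along the segment.\<close>
  proof (cases "s - r = r")
    case True
    then have "x = r" "y = r" using bnd s_def by auto
    then show ?thesis using True by simp
  next
    case False
    define w where "w = (x - (s - r)) / (r - (s - r))"
    have w: "0 \<le> w" "w \<le> 1" using False r bnd by (auto simp: w_def)
    have "w * (r - (s - r)) = x - (s - r)" using False by (simp add: w_def)
    then have "x = (1 - w) * (s - r) + w * r" "y = (1 - w) * r + w * (s - r)"
      by (auto simp: s_def algebra_simps)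
    then show ?thesis using w by (auto simp: in_segment)
  qed
  then have "(l, x, y) \<in> closed_segment (l, s - r, r) (l, r, s - r)"
    by (auto simp: in_segment algebra_simps)
  also have "\<dots> \<subseteq> convex hull (bilinear_graph l)"
    unfolding segment_convex_hull using mem by (intro hull_mono) auto
  finally show "(l, x, y) \<in> convex hull (bilinear_graph l)" .
qed

text \<open>The cone is itself a hull, so each inclusion needs only generators: the graph lies in
  the cone, and the apex (the graph point over x = y = 1) and the base lie in the hull of the
  graph.\<close>

lemma convex_hull_bilinear_graph:
  assumes l: "0 < l" "l < 1"
  shows "convex hull (bilinear_graph l) = cone_over 1 (1 - l) (1, 1) (base_region l)"
proof -
  have "(1, l) \<in> base_region l" using l by (simp add: base_region_def)
  then have cone: "cone_over 1 (1 - l) (1, 1) (base_region l) =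
      convex hull (insert (1, 1, 1) ({l} \<times> base_region l))"
    using cone_over_eq_hull[OF convex_base_region[OF l(1)], of 1 "1 - l" "(1, 1)"] by force
  have "(1, 1, 1) \<in> convex hull (bilinear_graph l)"
    using l by (intro hull_inc) (simp add: bilinear_graph_def)
  then show ?thesis
    using bilinear_graph_subset_cone[OF l] base_region_subset_hull[OF l]
    unfolding cone by (intro antisym hull_minimal) auto
qed

section \<open>Transfer to three-dimensional Euclidean space\<close>

definition vec_of_triple :: "real \<times> real \<times> real \<Rightarrow> real ^ 3" where
  "vec_of_triple = (\<lambda>(z, x, y). vector [x, y, z])"

lemma vec_of_triple_nth [simp]:
  "vec_of_triple (z, x, y) $ 1 = x" "vec_of_triple (z, x, y) $ 2 = y"
  "vec_of_triple (z, x, y) $ 3 = z"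
  by (simp_all add: vec_of_triple_def)

lemma linear_vec_of_triple: "linear vec_of_triple"
  by (rule linearI) (auto simp: vec_eq_iff forall_3)

lemma inj_vec_of_triple: "inj vec_of_triple"
  by (auto simp: inj_def vec_eq_iff forall_3)

lemma measurable_vec_of_triple [measurable]: "vec_of_triple \<in> borel_measurable borel"
  using linear_vec_of_triple
  by (intro borel_measurable_continuous_onI linear_continuous_on)
     (simp add: linear_conv_bounded_linear)

lemma bounded_product_graph_eq_image:
  "bounded_product_graph l = vec_of_triple ` bilinear_graph l"
proof (intro antisym subsetI)
  fix v assume "v \<in> bounded_product_graph l"
  then show "v \<in> vec_of_triple ` bilinear_graph l"
    by (intro image_eqI[of _ _ "(v $ 3, v $ 1, v $ 2)"])
       (auto simp: vec_eq_iff forall_3 bounded_product_graph_def bilinear_graph_def)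
qed (auto simp: bounded_product_graph_def bilinear_graph_def)

text \<open>Lebesgue measure is determined by its values on boxes, and the preimage of a box is the
  box with its sides permuted.\<close>

lemma distr_vec_of_triple: "distr lborel borel vec_of_triple = lborel"
proof (rule lborel_eqI[symmetric])
  fix a b :: "real ^ 3"
  assume le: "\<And>i. i \<in> Basis \<Longrightarrow> a \<bullet> i \<le> b \<bullet> i"
  have le': "a $ i \<le> b $ i" for i
    using le[of "axis i 1"] by (simp add: inner_axis)
  have "vec_of_triple -` box a b = box (a $ 3, a $ 1, a $ 2) (b $ 3, b $ 1, b $ 2)"
    by (auto simp: mem_box_cart forall_3 mem_box(1)[where 'a="real \<times> real \<times> real"] Basis_prod_def ball_Un)
  then have "emeasure (distr lborel borel vec_of_triple) (box a b) =
      emeasure lborel (box (a $ 3, a $ 1, a $ 2) (b $ 3, b $ 1, b $ 2))"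
    by (simp add: emeasure_distr)
  also have "\<dots> = (\<Prod>i\<in>UNIV. b $ i - a $ i)"
  proof (subst emeasure_lborel_box)
    have basis: "(Basis :: (real \<times> real \<times> real) set) = {(1, 0, 0), (0, 1, 0), (0, 0, 1)}"
      by (auto simp: Basis_prod_def image_Un zero_prod_def)
    show "(a $ 3, a $ 1, a $ 2) \<bullet> i \<le> (b $ 3, b $ 1, b $ 2) \<bullet> i"
      if "i \<in> Basis" for i :: "real \<times> real \<times> real"
      using that le' unfolding basis by auto
    show "ennreal (\<Prod>i\<in>Basis. ((b $ 3, b $ 1, b $ 2) - (a $ 3, a $ 1, a $ 2)) \<bullet> i) =
        ennreal (\<Prod>i\<in>UNIV. b $ i - a $ i)"
      unfolding basis UNIV_3 by (simp add: mult_ac)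
  qed
  also have "(\<Prod>i\<in>UNIV. b $ i - a $ i) = (\<Prod>i\<in>Basis. (b - a) \<bullet> i)"
  proof -
    have basis3: "Basis = range (\<lambda>i :: 3. axis i (1 :: real))"
      by (auto simp: Basis_vec_def)
    have "inj (\<lambda>i :: 3. axis i (1 :: real))"
      by (auto simp: inj_def axis_eq_axis)
    then show ?thesis
      using prod.reindex[of "\<lambda>i :: 3. axis i (1 :: real)" UNIV "\<lambda>i. (b - a) \<bullet> i"]
      by (simp add: basis3 inner_axis)
  qed
  finally show "emeasure (distr lborel borel vec_of_triple) (box a b) = (\<Prod>i\<in>Basis. (b - a) \<bullet> i)" .
qed simp

text \<open>Compactness makes the image Borel, where \<open>lebesgue\<close> and
  \<open>lborel\<close> agree; injectivity turns the preimage of the image back into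
  \<open>S\<close>.\<close>

lemma measure_vec_of_triple_image:
  assumes "compact S"
  shows "measure lebesgue (vec_of_triple ` S) = measure lborel S"
proof -
  have "compact (vec_of_triple ` S)"
    using assms linear_vec_of_triple
    by (intro compact_continuous_image linear_continuous_on)
       (simp_all add: linear_conv_bounded_linear)
  then have meas: "vec_of_triple ` S \<in> sets borel" by (rule borel_compact)
  then have "measure lebesgue (vec_of_triple ` S) =
      measure (distr lborel borel vec_of_triple) (vec_of_triple ` S)"
    by (simp add: distr_vec_of_triple)
  also have "\<dots> = measure lborel (vec_of_triple -` (vec_of_triple ` S))"
    using meas by (simp add: measure_distr)
  finally show ?thesis by (simp add: inj_vec_of_triple inj_vimage_image_eq)
qed

theorem mainTheorem11:
  fixes l\<^sub>z :: real
  assumes "0 < l\<^sub>z" and "l\<^sub>z < 1"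
  shows "measure lebesgue (convex hull (bounded_product_graph l\<^sub>z)) =
           (1 - l\<^sub>z) / 6 * (1 + 2 * l\<^sub>z * ln l\<^sub>z - l\<^sub>z\<^sup>2)"
proof -
  let ?C = "cone_over 1 (1 - l\<^sub>z) (1, 1) (base_region l\<^sub>z)"
  have "measure lebesgue (convex hull (bounded_product_graph l\<^sub>z)) =
      measure lebesgue (vec_of_triple ` ?C)"
    using assms by (simp add: bounded_product_graph_eq_image convex_hull_bilinear_graph
        convex_hull_linear_image[OF linear_vec_of_triple, symmetric])
  also have "\<dots> = measure lborel ?C"
    by (intro measure_vec_of_triple_image compact_cone_over compact_base_region assms)
  \<comment> \<open>The 3 is \<open>DIM('a) + 1\<close> for the planar base.\<close>
  also have "\<dots> = (1 - l\<^sub>z) * measure lborel (base_region l\<^sub>z) / 3"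
    using emeasure_cone_over[OF compact_base_region[OF assms(1)], of "1 - l\<^sub>z" 1 "(1, 1)"] assms
    by (simp add: measure_def[of lborel ?C])
  also have "\<dots> = (1 - l\<^sub>z) / 6 * (1 + 2 * l\<^sub>z * ln l\<^sub>z - l\<^sub>z\<^sup>2)"
    using assms by (simp add: measure_base_region field_simps)
  finally show ?thesis .
qed

end
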